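(* Let $\pi_0,\pi_1,\pi_2,\pi_3\ge0$ with $\sum_i\pi_i=1$, and let $a=\pi_0+\pi_3$, $b=\pi_1+\pi_2$, $c=\pi_0-\pi_3$, $d=\pi_1-\pi_2$, where $c$ and $d$ have the same sign and (without loss of generality) $a>b$ and $|c|\ge|d|$. Let the $N$ qubits be divided into $M$ groups of $k$ qubits each, $N=Mk$, with $k$ fixed. If both the number of partitions $M$ and the number of qubits $N$ are allowed to become (arbitrarily) large, the inequality $$\log|c|>\frac{k}{N}\log b+\Big(1-\frac{k}{N}\Big)\log a+\frac1N\left[\log\Big(1+\Big(\frac ba\Big)^{N-2k}\Big)-\log\Big(1+\Big|\frac dc\Big|^{N}\Big)\right]$$ ceases to be satisfied, i.e. it fails for all sufficiently large $N$.
   Context: Background for the quantities: an $N$-qubit cat state $\frac{1}{\sqrt2}(|0\rangle^{\otimes N}+|1\rangle^{\otimes N})$ is sent qubit by qubit through the channel $S(\rho)=\pi_0\rho+\sum_{i=1}^3\pi_i\sigma_i\rho\sigma_i$ ($\sigma_i$ the Pauli matrices). The displayed inequality is the logarithmic form of the sufficient condition $|c|^N+|d|^N>a^kb^{N-k}+b^ka^{N-k}$ for the output state to be entangled across a bipartite cut $k:(N-k)$; logarithms are assumed defined ($b>0$, $c\neq0$).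
   Formalization: The formal theorem adds the hypothesis |c| ≠ a (that is, π_0 and π_3 are both nonzero); when |c| = a, e.g. π = (3/4, 1/4, 0, 0), the inequality in fact holds for all large N, so the claim as stated fails there. *)

theory Defs
  imports Complex_Main
begin

text \<open>
  Logarithm of \<open>\<bar>c\<bar>^N + \<bar>d\<bar>^N > a^k b^(N-k) + b^k a^(N-k)\<close> after factoring out \<open>\<bar>c\<bar>^N\<close> and
  \<open>b^k a^(N-k)\<close>, divided by \<open>N\<close>. The exponent \<open>N - 2 k\<close> is negative when \<open>N < 2 k\<close>, hence \<open>powi\<close>.
\<close>

definition log_cut_condition :: "real \<Rightarrow> real \<Rightarrow> real \<Rightarrow> real \<Rightarrow> nat \<Rightarrow> nat \<Rightarrow> bool" where
  "log_cut_condition a b c d k N \<longleftrightarrow>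
     ln \<bar>c\<bar> > (real k / real N) * ln b + (1 - real k / real N) * ln a
       + (1 / real N) * (ln (1 + (b / a) powi (int N - 2 * int k)) - ln (1 + \<bar>d / c\<bar> ^ N))"

text \<open>
  With \<open>a = \<pi>\<^sub>0 + \<pi>\<^sub>3\<close> and \<open>c = \<pi>\<^sub>0 - \<pi>\<^sub>3\<close>, the case \<open>\<bar>c\<bar> = a\<close> occurs exactly when \<open>\<pi>\<^sub>0 = 0\<close> or \<open>\<pi>\<^sub>3 = 0\<close>.
  In it the condition holds for all large \<open>N\<close>, so a claim that it eventually fails has to exclude it.
\<close>

lemma log_cut_condition_degenerate:
  fixes a b c d :: real and k :: nat
  assumes "0 < b" "b < a" "\<bar>c\<bar> = a" "k \<ge> 1"
  shows "\<exists>N0. \<forall>N\<ge>N0. log_cut_condition a b c d k N"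
proof -
  define r where "r = b / a"
  have r: "0 < r" "r < 1" using assms by (auto simp: r_def)
  have "(\<lambda>n. r ^ n) \<longlonglongrightarrow> 0" using r by (intro LIMSEQ_power_zero) auto
  moreover have "0 < 1 / r - 1" using r by simp
  ultimately have "eventually (\<lambda>n. r ^ n < 1 / r - 1) sequentially"
    by (rule order_tendstoD)
  then obtain n0 where n0: "\<And>n. n \<ge> n0 \<Longrightarrow> r ^ n < 1 / r - 1"
    by (auto simp: eventually_sequentially)
  have "log_cut_condition a b c d k N" if N: "N \<ge> n0 + 2 * k + 1" for N
  proof -
    define x where "x = (b / a) powi (int N - 2 * int k)"
    define y where "y = ln (1 + \<bar>d / c\<bar> ^ N)"
    have e: "int N - 2 * int k = int (N - 2 * k)" using N by simp
    have x: "x = r ^ (N - 2 * k)" unfolding x_def e r_def by simp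
    have x1: "0 < x" "1 + x < 1 / r"
      using n0[of "N - 2 * k"] N r unfolding x by (simp, linarith)
    have "ln (1 + x) < ln (1 / r)" using x1 r by (subst ln_less_cancel_iff) auto
    also have "ln (1 / r) = ln a - ln b" using assms by (simp add: r_def ln_div)
    also have "\<dots> \<le> real k * (ln a - ln b)"
      using assms mult_right_mono[of 1 "real k" "ln a - ln b"] by simp
    finally have h: "ln (1 + x) < real k * (ln a - ln b)" .
    have y: "0 \<le> y" unfolding y_def by (intro ln_ge_zero) simp
    have Np: "0 < real N" using N by simp
    have "(real k / real N) * ln b + (1 - real k / real N) * ln a + (1 / real N) * (ln (1 + x) - y)
        = ln a + (ln (1 + x) - y - real k * (ln a - ln b)) / real N"
      using Np by (simp add: field_simps)
    also have "\<dots> < ln a" using h y Np by (simp add: divide_less_0_iff)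
    finally show ?thesis
      unfolding log_cut_condition_def x_def[symmetric] y_def[symmetric] using assms by simp
  qed
  then show ?thesis by blast
qed

end

theory Submission
  imports Defs
begin

text \<open>
  Multiplied by \<open>N\<close>, the right-hand side minus the left-hand side of the inequality is
  \<open>N (ln a - ln \<bar>c\<bar>)\<close> up to a term bounded in \<open>N\<close>: \<open>ln (1 + (b/a)^(N - 2k)) \<ge> 0\<close>, and
  \<open>ln (1 + \<bar>d/c\<bar>^N) \<le> ln 2\<close> because \<open>\<bar>d\<bar> \<le> \<bar>c\<bar>\<close>. When \<open>\<bar>c\<bar> < a\<close> the linear term wins.
\<close>

lemma not_log_cut_condition:
  fixes a b c d :: real and k N :: nat
  assumes "0 < b" "0 < a" "c \<noteq> 0" "\<bar>d\<bar> \<le> \<bar>c\<bar>" "N > 0"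
    and large: "real k * (ln a - ln b) + ln 2 \<le> real N * (ln a - ln \<bar>c\<bar>)"
  shows "\<not> log_cut_condition a b c d k N"
proof -
  define x where "x = ln (1 + (b / a) powi (int N - 2 * int k))"
  define y where "y = ln (1 + \<bar>d / c\<bar> ^ N)"
  \<comment> \<open>As \<open>b / a\<close> is positive, so is its integer power for either sign of
    the exponent; this covers \<open>N < 2 * k\<close> too.\<close>
  have x: "0 \<le> x"
    unfolding x_def using assms by (intro ln_ge_zero) simp
  have "\<bar>d / c\<bar> ^ N \<le> 1"
    using assms by (intro power_le_one) auto
  moreover have "0 \<le> \<bar>d / c\<bar> ^ N" by simp
  ultimately have y: "y \<le> ln 2"
    unfolding y_def by (subst ln_le_cancel_iff) linarith+
  \<comment> \<open>Right side minus left side over the common denominator \<open>N\<close>. By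
    \<open>large\<close>, the first two terms of the numerator amount to at least
    \<open>ln 2\<close>, which absorbs \<open>- y\<close>.\<close>
  have "(real k / real N) * ln b + (1 - real k / real N) * ln a + (1 / real N) * (x - y) - ln \<bar>c\<bar>
      = (real N * (ln a - ln \<bar>c\<bar>) - real k * (ln a - ln b) + x - y) / real N"
    using \<open>N > 0\<close> by (simp add: field_simps)
  also have "\<dots> \<ge> 0"
    using large x y by (intro divide_nonneg_nonneg) linarith+
  finally show ?thesis
    unfolding log_cut_condition_def x_def[symmetric] y_def[symmetric] by linarith
qed

theorem proposition3:
  fixes \<pi> :: "nat \<Rightarrow> real" and a b c d :: real and k :: nat
  assumes "\<And>i. i \<in> {0..3} \<Longrightarrow> 0 \<le> \<pi> i"
    and "(\<Sum>i=0..3. \<pi> i) = 1"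
    and "a = \<pi> 0 + \<pi> 3" and "b = \<pi> 1 + \<pi> 2"
    and "c = \<pi> 0 - \<pi> 3" and "d = \<pi> 1 - \<pi> 2"
    and "0 \<le> c * d"
    and "a > b" and "\<bar>c\<bar> \<ge> \<bar>d\<bar>"
    and "b > 0" and "c \<noteq> 0"
    and "\<bar>c\<bar> \<noteq> a"
    and "k \<ge> 1"
  shows "\<exists>N0. \<forall>M N. N = M * k \<and> N \<ge> N0 \<longrightarrow> \<not> log_cut_condition a b c d k N"
proof -
  \<comment> \<open>Nonnegativity gives \<open>\<bar>c\<bar> \<le> a\<close>; with equality
    excluded, the term linear in \<open>N\<close> has positive slope.\<close>
  have "0 \<le> \<pi> 0" "0 \<le> \<pi> 3"
    using assms(1) by auto
  with \<open>\<bar>c\<bar> \<noteq> a\<close> have ca: "\<bar>c\<bar> < a"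
    unfolding \<open>a = \<pi> 0 + \<pi> 3\<close> \<open>c = \<pi> 0 - \<pi> 3\<close> by linarith
  have a: "0 < a"
    using \<open>a > b\<close> \<open>b > 0\<close> by linarith
  have "0 < ln a - ln \<bar>c\<bar>"
    using ca a \<open>c \<noteq> 0\<close> by simp
  \<comment> \<open>With \<open>k\<close> fixed, the left side is a constant that a large multiple
    of the slope exceeds.\<close>
  then obtain N0 where N0: "real k * (ln a - ln b) + ln 2 < real N0 * (ln a - ln \<bar>c\<bar>)"
    using reals_Archimedean3 by blast
  \<comment> \<open>\<open>Suc\<close> makes \<open>N > 0\<close> immediate, as the division by
    \<open>N\<close> requires.\<close>
  have "\<not> log_cut_condition a b c d k N" if "N \<ge> Suc N0" for N
  proof (rule not_log_cut_condition)
    have "real N0 * (ln a - ln \<bar>c\<bar>) \<le> real N * (ln a - ln \<bar>c\<bar>)"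
      using that \<open>0 < ln a - ln \<bar>c\<bar>\<close> by (intro mult_right_mono) auto
    with N0 show "real k * (ln a - ln b) + ln 2 \<le> real N * (ln a - ln \<bar>c\<bar>)"
      by linarith
  qed (use assms a that in auto)
  then show ?thesis by blast
qed

end
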